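(* Let $p$ be a prime number and let $q=p^f$ with $f\ge 1$. The series $\Psi_q(T)$ is $p$-adically entire, i.e. it converges for every value $T \in \mathbb{C}_p$.
   Context: $\mathbb{C}_p$ is the completion of an algebraic closure of $\mathbb{Q}_p$. $\Psi_q(T) \in T + T^2\mathbb{Z}[[T]]$ is the unique power series of this form satisfying $\sum_{j=0}^\infty p^{-j}\Psi_q(p^jT)^{q^j} = T$. *)

theory Defs
  imports "HOL-Algebra.Algebraic_Closure_Type" "HOL-Analysis.Analysis"
begin

section \<open>The field of \<open>p\<close>-adic complex numbers\<close>

definition padic_abs :: "nat \<Rightarrow> rat \<Rightarrow> real" where
  "padic_abs p r =
     (if r = 0 then 0
      else real p powi (int (multiplicity (int p) (snd (quotient_of r)))
                        - int (multiplicity (int p) (fst (quotient_of r)))))"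

text \<open>The metric of the ambient type is the one induced by an ultrametric absolute value,
  which is recovered as \<open>\<bar>x\<bar> = dist x 0\<close>. (The class \<open>real_normed_field\<close> is not usable here,
  since it makes the absolute value archimedean.)\<close>

definition ultrametric_valued_field :: "'a::{field, metric_space} itself \<Rightarrow> bool" where
  "ultrametric_valued_field _ \<longleftrightarrow>
     (\<forall>x y :: 'a. dist x y = dist (x - y) 0) \<and>
     (\<forall>x y :: 'a. dist (x * y) 0 = dist x 0 * dist y 0) \<and>
     (\<forall>x y :: 'a. dist (x + y) 0 \<le> max (dist x 0) (dist y 0))"

definition completion_of :: "'a::metric_space set \<Rightarrow> 'a set \<Rightarrow> bool" where
  "completion_of A B \<longleftrightarrow> A \<subseteq> B \<and> B \<subseteq> closure A \<and> complete B"

text \<open>The type \<^typ>\<open>'a\<close>, with its metric, is a model of \<open>\<complex>\<^sub>p\<close>: inside it, \<open>Qp\<close> is the completion of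
  \<open>\<rat>\<close> for the \<open>p\<close>-adic absolute value, \<open>Qpbar\<close> is an algebraic closure of \<open>Qp\<close>, and the
  whole type is the completion of \<open>Qpbar\<close>. These data determine \<^typ>\<open>'a\<close> up to isometric
  isomorphism, because the absolute value of \<open>Qp\<close> extends uniquely to \<open>Qpbar\<close>.\<close>

locale padic_complex_numbers =
  fixes p :: nat and Qp Qpbar :: "'a::{field_char_0, metric_space} set"
  assumes valued: "ultrametric_valued_field TYPE('a)"
    and padic: "\<And>r. dist (of_rat r :: 'a) 0 = padic_abs p r"
    and Qp_completion: "completion_of \<rat> Qp"
    and Qpbar_closure: "algebraic_closure (ring_of_type_algebra\<lparr>carrier := Qpbar\<rparr>) Qp"
    and Cp_completion: "completion_of Qpbar UNIV"


section \<open>The series \<open>\<Psi>\<^sub>q\<close>\<close>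

text \<open>The infinite sum below is taken in the \<open>T\<close>-adic topology of \<open>\<rat>[[T]]\<close>, which is the
  topology of the type \<^typ>\<open>rat fps\<close>.\<close>

definition rat_fps :: "int fps \<Rightarrow> rat fps" where
  "rat_fps F = Abs_fps (\<lambda>n. of_int (fps_nth F n))"

definition is_Psi :: "nat \<Rightarrow> nat \<Rightarrow> int fps \<Rightarrow> bool" where
  "is_Psi p q \<Psi> \<longleftrightarrow>
     fps_nth \<Psi> 0 = 0 \<and> fps_nth \<Psi> 1 = 1 \<and>
     (\<lambda>j. fps_const (1 / of_nat p ^ j) *
          (rat_fps \<Psi> oo (fps_const (of_nat p ^ j) * fps_X)) ^ (q ^ j)) sums fps_X"

definition Psi :: "nat \<Rightarrow> nat \<Rightarrow> int fps" where
  "Psi p q = (THE \<Psi>. is_Psi p q \<Psi>)"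


text \<open>Existence and uniqueness, so that the definite description is meaningful: comparing
  coefficients turns the defining identity into the fixed-point equation of \<open>Psi_step\<close>, which
  expresses the \<open>n\<close>-th coefficient as an integer polynomial in the earlier ones.\<close>

lemma rat_fps_power: "rat_fps (F ^ k) = rat_fps F ^ k"
proof (induction k)
  case 0 show ?case by (auto simp: rat_fps_def fps_eq_iff)
next
  case (Suc k)
  have "rat_fps (F * G) = rat_fps F * rat_fps G" for F G :: "int fps"
    by (auto simp: rat_fps_def fps_eq_iff fps_mult_nth)
  then show ?case using Suc by simp
qed

definition Psi_step :: "nat \<Rightarrow> nat \<Rightarrow> int fps \<Rightarrow> int fps" where
  "Psi_step p q F = fps_X - Abs_fps (\<lambda>n. \<Sum>j=1..n. int p ^ (j * (n - 1)) * fps_nth (F ^ (q ^ j)) n)"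

lemma fps_power_nth_cong:
  fixes F G :: "int fps"
  assumes "\<And>k. k < n \<Longrightarrow> fps_nth F k = fps_nth G k" "fps_nth F 0 = 0" "fps_nth G 0 = 0" "m \<ge> 2"
  shows "fps_nth (F ^ m) n = fps_nth (G ^ m) n"
proof -
  have low: "fps_nth (F ^ k) i = fps_nth (G ^ k) i" if "i < n" for k i
    using that
  proof (induction k arbitrary: i)
    case (Suc k) then show ?case using assms(1) by (auto simp: fps_mult_nth intro!: sum.cong)
  qed auto
  obtain k where m: "m = Suc (Suc k)" using assms(4) by (metis Suc_le_D numeral_2_eq_2 Suc_le_mono)
  have z: "fps_nth (F ^ Suc k) 0 = 0" "fps_nth (G ^ Suc k) 0 = 0" using assms by auto
  show ?thesis unfolding m power_Suc[of _ "Suc k"] fps_mult_nth[of _ _ n]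
  proof (rule sum.cong)
    fix i assume i: "i \<in> {0..n}"
    show "fps_nth F i * fps_nth (F ^ Suc k) (n - i) = fps_nth G i * fps_nth (G ^ Suc k) (n - i)"
    proof (cases "i = 0 \<or> i = n")
      case True then show ?thesis using assms(2,3) z by auto
    next
      case False then have "i < n" "n - i < n" using i by auto
      then show ?thesis using low[of "n-i" "Suc k"] assms(1)[of i] by presburger
    qed
  qed simp
qed

lemma is_Psi_iff:
  assumes p: "p > 0" and q: "q \<ge> 2"
  shows "is_Psi p q F \<longleftrightarrow> fps_nth F 0 = 0 \<and> F = Psi_step p q F"
proof (cases "fps_nth F 0 = 0")
  case F0: True
  define t where "t = (\<lambda>j. fps_const (1 / of_nat p ^ j) *
          (rat_fps F oo (fps_const (of_nat p ^ j) * fps_X)) ^ (q ^ j))"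
  have big: "j < q ^ j" for j
    using q less_exp[of j] power_mono[of 2 q j] by linarith
  have tn: "fps_nth (t j) n = of_int (int p ^ (j * (n-1)) * fps_nth (F ^ (q ^ j)) n)" for j n
  proof (cases n)
    case 0
    have "fps_nth (F ^ (q^j)) 0 = 0" using F0 big[of j] by (metis fps_nth_power_0 power_0_left not_less0)
    moreover have "fps_nth (rat_fps F oo (fps_const (of_nat p ^ j) * fps_X)) 0 = 0" using F0 by (simp add: rat_fps_def)
    ultimately show ?thesis using 0 big[of j] q unfolding t_def
      by (simp add: fps_nth_power_0 power_0_left rat_fps_def F0)
  next
    case (Suc k)
    have "(rat_fps F oo (fps_const (of_nat p ^ j) * fps_X)) ^ (q ^ j) = rat_fps (F ^ q ^ j) oo (fps_const (of_nat p ^ j) * fps_X)"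
      by (subst fps_compose_power) (auto simp: rat_fps_power)
    then have "fps_nth (t j) n = 1 / of_nat p ^ j * ((of_nat p ^ j) ^ n * of_int (fps_nth (F ^ (q^j)) n))"
      unfolding t_def by (simp add: fps_compose_linear rat_fps_def)
    also have "\<dots> = of_nat p ^ (j * k) * of_int (fps_nth (F ^ (q^j)) n)"
      using p Suc by (simp add: power_add power_mult field_simps)
    finally show ?thesis using Suc by simp
  qed
  have tz: "fps_nth (t j) n = 0" if "n < j" for n j
    unfolding tn using startsby_zero_power_prefix[OF F0, of "q ^ j"] that big[of j] by auto
  have part: "fps_nth (\<Sum>j<N. t j) n = (\<Sum>j\<le>n. fps_nth (t j) n)" if "n < N" for N n
  proof -
    have "fps_nth (\<Sum>j<N. t j) n = (\<Sum>j<N. fps_nth (t j) n)" by (simp add: fps_sum_nth)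
    also have "\<dots> = (\<Sum>j\<le>n. fps_nth (t j) n)"
      using that tz by (intro sum.mono_neutral_right) auto
    finally show ?thesis .
  qed
  have ev: "eventually (\<lambda>N. fps_nth (\<Sum>j<N. t j) n = c) sequentially \<longleftrightarrow> (\<Sum>j\<le>n. fps_nth (t j) n) = c" for n c
  proof
    assume "eventually (\<lambda>N. fps_nth (\<Sum>j<N. t j) n = c) sequentially"
    then obtain M where "\<forall>N\<ge>M. fps_nth (\<Sum>j<N. t j) n = c" by (auto simp: eventually_sequentially)
    then show "(\<Sum>j\<le>n. fps_nth (t j) n) = c" using part[of n "max M (Suc n)"] by (metis max.cobounded1 max.cobounded2 Suc_le_lessD)
  next
    assume "(\<Sum>j\<le>n. fps_nth (t j) n) = c"
    then show "eventually (\<lambda>N. fps_nth (\<Sum>j<N. t j) n = c) sequentially"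
      using part unfolding eventually_sequentially by (metis Suc_le_lessD)
  qed
  have split: "(\<Sum>j\<le>n. fps_nth (t j) n) = of_int (fps_nth F n + (\<Sum>j=1..n. int p ^ (j * (n - 1)) * fps_nth (F ^ (q ^ j)) n))" for n
  proof -
    have "{..n} = insert 0 {1..n}" by auto
    then show ?thesis by (simp add: tn)
  qed
  have "t sums fps_X \<longleftrightarrow> (\<forall>n. (\<Sum>j\<le>n. fps_nth (t j) n) = fps_nth fps_X n)"
    unfolding sums_def tendsto_fps_iff ev ..
  also have "\<dots> \<longleftrightarrow> (\<forall>n. fps_nth F n + (\<Sum>j=1..n. int p ^ (j * (n - 1)) * fps_nth (F ^ (q ^ j)) n) = fps_nth fps_X n)"
  proof -
    have "(of_int a = (fps_nth fps_X n :: rat)) = (a = fps_nth fps_X n)" for a n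
      by (auto simp: fps_X_def)
    then show ?thesis unfolding split by (simp only:)
  qed
  also have "\<dots> \<longleftrightarrow> F = Psi_step p q F" unfolding fps_eq_iff Psi_step_def by (auto simp: algebra_simps)
  finally have *: "t sums fps_X \<longleftrightarrow> F = Psi_step p q F" .
  have "fps_nth F 1 = 1" if "F = Psi_step p q F"
  proof -
    have "fps_nth (F ^ q) 1 = 0" using startsby_zero_power_prefix[OF F0, of q] q by auto
    then have "fps_nth (Psi_step p q F) 1 = 1" by (simp add: Psi_step_def)
    then show ?thesis using that by simp
  qed
  then show ?thesis using * F0 unfolding is_Psi_def t_def rat_fps_def by blast
qed (simp add: is_Psi_def)

lemma Psi_step_nth_0: "fps_nth (Psi_step p q F) 0 = 0" by (simp add: Psi_step_def)

lemma Psi_step_nth_cong: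
  assumes q: "q \<ge> 2" and "\<And>k. k < n \<Longrightarrow> fps_nth F k = fps_nth G k" "fps_nth F 0 = 0" "fps_nth G 0 = 0"
  shows "fps_nth (Psi_step p q F) n = fps_nth (Psi_step p q G) n"
proof -
  have "fps_nth (F ^ (q ^ j)) n = fps_nth (G ^ (q ^ j)) n" if "j \<ge> 1" for j
  proof (rule fps_power_nth_cong[OF assms(2-4)])
    show "2 \<le> q ^ j" using power_increasing[OF that, of q] q by simp
  qed auto
  then show ?thesis unfolding Psi_step_def by (auto intro!: sum.cong)
qed

lemma ex1_is_Psi:
  assumes p: "p > 0" and q: "q \<ge> 2"
  shows "\<exists>!F. is_Psi p q F"
proof -
  define I where "I k = (Psi_step p q ^^ k) 0" for k
  have I0: "fps_nth (I k) 0 = 0" for k by (cases k) (auto simp: I_def Psi_step_nth_0)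
  have st: "fps_nth (I (Suc k)) n = fps_nth (I k) n" if "n < k" for k n
    using that
  proof (induction k arbitrary: n)
    case (Suc k)
    have "fps_nth (Psi_step p q (I (Suc k))) n = fps_nth (Psi_step p q (I k)) n"
      by (rule Psi_step_nth_cong[OF q _ I0 I0]) (use Suc in auto)
    then show ?case by (simp add: I_def)
  qed simp
  have st': "fps_nth (I (Suc n + d)) n = fps_nth (I (Suc n)) n" for n d
    by (induction d) (auto simp: st)
  define F where "F = Abs_fps (\<lambda>n. fps_nth (I (Suc n)) n)"
  have FI: "fps_nth F k = fps_nth (I n) k" if "k < n" for k n
    using st'[of k "n - Suc k"] that by (simp add: F_def)
  have F0: "fps_nth F 0 = 0" by (simp add: F_def I0)
  have "F = Psi_step p q F"
  proof (rule fps_ext)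
    fix n
    have "fps_nth F n = fps_nth (Psi_step p q (I n)) n" by (simp add: F_def I_def)
    also have "\<dots> = fps_nth (Psi_step p q F) n"
      by (rule Psi_step_nth_cong[OF q _ I0 F0]) (simp add: FI)
    finally show "fps_nth F n = fps_nth (Psi_step p q F) n" .
  qed
  moreover have "G = F" if "fps_nth G 0 = 0" "G = Psi_step p q G" for G
  proof -
    have "fps_nth G n = fps_nth F n" for n
    proof (induction n rule: less_induct)
      case (less n)
      then show ?case using Psi_step_nth_cong[OF q less that(1) F0] that(2) \<open>F = Psi_step p q F\<close> by metis
    qed
    then show ?thesis by (simp add: fps_eq_iff)
  qed
  ultimately show ?thesis unfolding is_Psi_iff[OF p q] using F0 by metis
qed

lemma is_Psi_Psi:
  assumes "p > 0" and "q \<ge> 2"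
  shows "is_Psi p q (Psi p q)"
  unfolding Psi_def by (rule theI'[OF ex1_is_Psi[OF assms]])

end

theory Submission
  imports Defs
begin

text \<open>A power series over \<open>\<int>\<close> that is bounded on the disc of radius \<open>p\<^sup>k\<close> satisfies
  \<open>p\<^sup>k\<^sup>n dvd p\<^sup>c a\<^sub>n\<close> for some \<open>c\<close>. In
  \<open>\<Psi>(T) = T - (\<Sum>j\<ge>1. p\<^sup>-\<^sup>j \<Psi>(p\<^sup>jT)^(q\<^sup>j))\<close> the arguments \<open>p\<^sup>jT\<close> on the right are smaller
  than \<open>T\<close> by a factor \<open>p\<close> at least, so boundedness on the disc of radius \<open>p\<^sup>k\<close> implies
  boundedness on that of radius \<open>p\<^sup>k\<^sup>+\<^sup>1\<close>; the terms with large \<open>j\<close> are harmless because there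
  \<open>p\<^sup>jT\<close> is in the unit disc and \<open>\<Psi>\<close> vanishes at \<open>0\<close>. Integrality of the coefficients is the
  case \<open>k = 0\<close>.\<close>

text \<open>In each term of the Cauchy product, \<open>a ^ n\<close> splits as
  \<open>a ^ i * a ^ (n - i)\<close>, one factor for each series. With \<open>a = p^k\<close> this
  says that bounds on the disc of radius p^k multiply.\<close>

lemma fps_mult_nth_dvd:
  fixes F G :: "'a::comm_semiring_1 fps"
  assumes "\<And>n. a ^ n dvd b * fps_nth F n" "\<And>n. a ^ n dvd c * fps_nth G n"
  shows "a ^ n dvd b * c * fps_nth (F * G) n"
proof -
  have "a ^ n dvd (b * fps_nth F i) * (c * fps_nth G (n - i))" if "i \<in> {0..n}" for i
  proof -
    have "a ^ n = a ^ i * a ^ (n - i)" using that by (simp flip: power_add)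
    then show ?thesis using assms by (simp add: mult_dvd_mono)
  qed
  then show ?thesis
    by (auto simp: fps_mult_nth sum_distrib_left ac_simps intro!: dvd_sum)
qed

lemma fps_power_nth_dvd:
  fixes F :: "'a::comm_semiring_1 fps"
  assumes "\<And>n. a ^ n dvd b * fps_nth F n"
  shows "a ^ n dvd b ^ m * fps_nth (F ^ m) n"
proof (induction m arbitrary: n)
  case 0
  show ?case by simp
next
  case (Suc m)
  show ?case using fps_mult_nth_dvd[OF assms Suc] by simp
qed

lemma Psi_nth_dvd:
  assumes p: "p > 0" and q: "q \<ge> 2"
  shows "\<exists>c. \<forall>n. (int p ^ k) ^ n dvd int p ^ c * fps_nth (Psi p q) n"
proof (induction k)
  case 0
  show ?case by simp
next
  case (Suc k)
  let ?F = "Psi p q"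
  obtain c where c: "\<And>n. (int p ^ k) ^ n dvd int p ^ c * fps_nth ?F n"
    using Suc by blast
  have F: "fps_nth ?F 0 = 0" "?F = Psi_step p q ?F"
    using is_Psi_Psi[OF assms] is_Psi_iff[OF assms] by auto
  \<comment> \<open>Both summands are worst cases over \<open>j \<le> Suc k\<close>:
    \<open>Suc k\<close> repays the exponent lost in \<open>j * (n - 1) = j * n - j\<close>, and
    \<open>c * q ^ Suc k\<close> pays the \<open>c * q ^ j\<close> that the \<open>q ^ j\<close>-th
    power costs. The first also settles the linear coefficient of \<open>fps_X\<close>.\<close>
  define d where "d = Suc k + c * q ^ Suc k"
  have term_dvd: "(int p ^ Suc k) ^ n dvd int p ^ d * (int p ^ (j * (n - 1)) * fps_nth (?F ^ (q ^ j)) n)"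
    if j: "j \<in> {1..n}" for j n
  proof (cases "j \<le> Suc k")
    case True
    have "c * q ^ j \<le> c * q ^ Suc k"
      using True q by (intro mult_left_mono power_increasing) auto
    moreover have jn: "j * n = j * (n - 1) + j"
      using j by (cases n) auto
    \<comment> \<open>The gain of one radius step: the induction hypothesis gives only p^(k*n), and
      the missing p^n comes out of p^(j*n) because j is at least 1.\<close>
    moreover have "n \<le> j * n" using j by simp
    ultimately have "n + c * q ^ j \<le> d + j * (n - 1)"
      using True unfolding d_def by linarith
    then obtain e where e: "d + j * (n - 1) = n + c * q ^ j + e"
      using le_iff_add by blast
    have "(int p ^ k) ^ n dvd (int p ^ c) ^ (q ^ j) * fps_nth (?F ^ (q ^ j)) n"
      by (rule fps_power_nth_dvd[OF c])
    then have "int p ^ n * (int p ^ k) ^ n dvd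
        (int p ^ n * int p ^ e) * ((int p ^ c) ^ (q ^ j) * fps_nth (?F ^ (q ^ j)) n)"
      by (intro mult_dvd_mono) auto
    also have "\<dots> = int p ^ (d + j * (n - 1)) * fps_nth (?F ^ (q ^ j)) n"
      unfolding e by (simp add: power_add power_mult)
    finally show ?thesis by (simp add: power_add power_mult_distrib mult.assoc)
  next
    case False
    show ?thesis
    proof (cases "n < q ^ j")
      case True
      \<comment> \<open>The constant term of \<open>?F\<close> is 0, so its \<open>q ^ j\<close>-th
        power has no term of degree below \<open>q ^ j\<close>.\<close>
      then show ?thesis using startsby_zero_power_prefix[OF F(1), of "q ^ j"] by simp
    next
      case n: False
      \<comment> \<open>Now \<open>k + 2 \<le> j \<le> n - 1\<close>, so j*(n-1) is at least
        (k+1)*(n-1) + (n-1), hence at least (k+1)*n: the explicit power of p suffices without the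
        induction hypothesis.\<close>
      have "j < q ^ j" using q by (simp add: power_gt_expt)
      then have jn: "j \<le> n - 1" using n by linarith
      obtain i where i: "j = Suc (Suc k) + i" using False le_iff_add
        by (metis not_less_eq_eq)
      obtain m where m: "n = Suc m" using j by (cases n) auto
      have "Suc k * m + Suc k \<le> Suc k * m + m" using jn i m by simp
      also have "\<dots> \<le> j * m" unfolding i by (simp add: algebra_simps)
      finally have "Suc k * n \<le> j * (n - 1)" by (simp add: m)
      then have "(int p ^ Suc k) ^ n dvd int p ^ (j * (n - 1))"
        unfolding power_mult[symmetric] by (rule le_imp_power_dvd)
      then show ?thesis by (simp add: dvd_mult dvd_mult2)
    qed
  qed
  have "(int p ^ Suc k) ^ n dvd int p ^ d * fps_nth ?F n" for n
  proof -
    have "fps_nth ?F n = fps_nth fps_X n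
        - (\<Sum>j=1..n. int p ^ (j * (n - 1)) * fps_nth (?F ^ (q ^ j)) n)"
      by (subst F(2)) (simp add: Psi_step_def)
    moreover have "(int p ^ Suc k) ^ n dvd int p ^ d * fps_nth fps_X n"
    proof (cases "n = 1")
      case True
      have "int p ^ Suc k dvd int p ^ d" by (rule le_imp_power_dvd) (simp add: d_def)
      then show ?thesis using True by simp
    qed (simp add: fps_X_def)
    ultimately show ?thesis using term_dvd
      by (simp only: right_diff_distrib sum_distrib_left) (intro dvd_diff dvd_sum)
  qed
  then show ?case by blast
qed

lemma padic_abs_of_int_le_1: "p > 0 \<Longrightarrow> padic_abs p (of_int b) \<le> 1"
  by (auto simp: padic_abs_def power_int_minus inverse_le_1_iff)

lemma padic_abs_of_nat_self: "Factorial_Ring.prime p \<Longrightarrow> padic_abs p (of_nat p) = 1 / real p"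
proof -
  assume p: "Factorial_Ring.prime p"
  have "quotient_of (of_nat p) = (int p, 1)" by (metis quotient_of_int of_int_of_nat_eq of_int_def)
  moreover have "multiplicity (int p) (int p) = 1"
    using p by (intro multiplicity_self) (auto simp: prime_gt_1_nat prime_gt_0_nat)
  ultimately show ?thesis
    using p by (auto simp: padic_abs_def power_int_minus field_simps)
qed

text \<open>By the ultrametric inequality a block of the series is no larger than its largest term,
  so terms tending to 0 already make the partial sums Cauchy.\<close>

lemma ultrametric_summable:
  fixes x :: "nat \<Rightarrow> 'a::{field, metric_space}"
  assumes "ultrametric_valued_field TYPE('a)" and "complete (UNIV :: 'a set)"
    and lim: "(\<lambda>n. dist (x n) 0) \<longlonglongrightarrow> 0"
  shows "summable x"
proof -
  have diff: "dist y z = dist (y - z) 0" and add: "dist (y + z) 0 \<le> max (dist y 0) (dist z 0)"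
    for y z :: 'a
    using assms(1) by (auto simp: ultrametric_valued_field_def)
  define S where "S = (\<lambda>n. \<Sum>i<n. x i)"
  have "Cauchy S"
  proof (rule metric_CauchyI)
    fix e :: real assume "e > 0"
    then obtain N where N: "\<And>n. n \<ge> N \<Longrightarrow> dist (x n) 0 < e"
      using lim by (auto simp: lim_sequentially)
    have tail: "dist (S (n + d)) (S n) < e" if "n \<ge> N" for n d
    proof (induction d)
      case 0
      show ?case using \<open>e > 0\<close> by simp
    next
      case (Suc d)
      have "dist (S (n + Suc d)) (S n) = dist ((S (n + d) - S n) + x (n + d)) 0"
        by (subst diff) (simp add: S_def algebra_simps)
      also have "\<dots> \<le> max (dist (S (n + d)) (S n)) (dist (x (n + d)) 0)"
        using add[of "S (n + d) - S n" "x (n + d)"] diff[of "S (n + d)" "S n"] by simp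
      also have "\<dots> < e" using Suc N[of "n + d"] that by simp
      finally show ?case .
    qed
    have "dist (S m) (S n) < e" if "m \<ge> N" "n \<ge> N" for m n
      using tail[OF that(1), of "n - m"] tail[OF that(2), of "m - n"]
      by (cases "m \<le> n") (auto simp: dist_commute)
    then show "\<exists>N. \<forall>m\<ge>N. \<forall>n\<ge>N. dist (S m) (S n) < e" by blast
  qed
  then obtain l where "S \<longlonglongrightarrow> l" using assms(2) unfolding complete_def by blast
  then show ?thesis by (auto simp: summable_def sums_def S_def)
qed

theorem proposition2p3:
  fixes p q f :: nat and Qp Qpbar :: "'a::{field_char_0, metric_space} set"
  assumes "Factorial_Ring.prime p" and "f \<ge> 1" and "q = p ^ f"
    and "padic_complex_numbers p Qp Qpbar"
  shows "\<forall>T :: 'a. summable (\<lambda>n. of_int (fps_nth (Psi p q) n) * T ^ n)"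
proof
  fix T :: 'a
  interpret padic_complex_numbers p Qp Qpbar by fact
  have p: "p \<ge> 2" "p > 0" using assms(1) by (auto simp: prime_ge_2_nat prime_gt_0_nat)
  have q: "q \<ge> 2" using p assms(2,3) power_increasing[of 1 f p] by simp
  have mult: "dist (x * y) 0 = dist x 0 * dist y 0" for x y :: 'a
    using valued by (auto simp: ultrametric_valued_field_def)
  have dist_1: "dist (1 :: 'a) 0 = 1" using mult[of 1 1] by simp
  have power: "dist (x ^ n) 0 = dist x 0 ^ n" for x :: 'a and n
    by (induction n) (simp_all add: mult dist_1)
  have int_le: "dist (of_int b :: 'a) 0 \<le> 1" for b
    using padic[of "of_int b"] padic_abs_of_int_le_1[OF p(2), of b] by simp
  have dist_p: "dist (of_nat p :: 'a) 0 = 1 / real p"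
    using padic[of "of_nat p"] padic_abs_of_nat_self[OF assms(1)] by simp
  \<comment> \<open>A disc with \<open>T\<close> strictly inside makes the bound on the terms a
    decaying geometric sequence.\<close>
  obtain k where "dist T 0 < real p ^ k"
    using real_arch_pow[of "real p" "dist T 0"] p by auto
  then have ratio: "\<bar>dist T 0 / real p ^ k\<bar> < 1" using p by simp
  obtain c where c: "\<And>n. (int p ^ k) ^ n dvd int p ^ c * fps_nth (Psi p q) n"
    using Psi_nth_dvd[OF p(2) q] by blast
  have bound: "dist (of_int (fps_nth (Psi p q) n) * T ^ n) 0 \<le> real p ^ c * (dist T 0 / real p ^ k) ^ n"
    for n
  proof -
    \<comment> \<open>Since |b| is at most 1 and |p| = 1/p, divisibility turns into an upper bound
      for the absolute value of the coefficient.\<close>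
    obtain b where "int p ^ c * fps_nth (Psi p q) n = (int p ^ k) ^ n * b"
      using c[of n] by (elim dvdE)
    then have "(of_int (int p ^ c * fps_nth (Psi p q) n) :: 'a) = of_int ((int p ^ k) ^ n * b)"
      by (rule arg_cong)
    then have "(of_nat p :: 'a) ^ c * of_int (fps_nth (Psi p q) n) = (of_nat p ^ k) ^ n * of_int b"
      by simp
    then have "(1 / real p) ^ c * dist (of_int (fps_nth (Psi p q) n) :: 'a) 0
        = ((1 / real p) ^ k) ^ n * dist (of_int b :: 'a) 0"
      by (metis mult power dist_p)
    also have "\<dots> \<le> ((1 / real p) ^ k) ^ n" using int_le[of b] by (simp add: mult_left_le)
    finally have "dist (of_int (fps_nth (Psi p q) n) :: 'a) 0 \<le> real p ^ c / (real p ^ k) ^ n"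
      using p by (simp add: field_simps)
    then have "dist (of_int (fps_nth (Psi p q) n) :: 'a) 0 * dist T 0 ^ n
        \<le> real p ^ c / (real p ^ k) ^ n * dist T 0 ^ n"
      by (rule mult_right_mono) simp
    then show ?thesis by (simp add: mult power power_divide)
  qed
  have "(\<lambda>n. real p ^ c * (dist T 0 / real p ^ k) ^ n) \<longlonglongrightarrow> 0"
    using tendsto_mult_right_zero[OF LIMSEQ_power_zero, of "dist T 0 / real p ^ k"] ratio by simp
  then have "(\<lambda>n. dist (of_int (fps_nth (Psi p q) n) * T ^ n) 0) \<longlonglongrightarrow> 0"
    by (rule tendsto_sandwich[OF _ _ tendsto_const, rotated 2]) (simp_all add: bound)
  moreover have "complete (UNIV :: 'a set)"
    using Cp_completion by (simp add: completion_of_def)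
  ultimately show "summable (\<lambda>n. of_int (fps_nth (Psi p q) n) * T ^ n)"
    by (intro ultrametric_summable[OF valued])
qed

end
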